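(* Let $\alpha$ be a positive (real) algebraic number such that the additive monoid $\mathbb{N}_0[\alpha]$ is atomic. Then the following conditions are equivalent. (a) $\mathbb{N}_0[\alpha]$ is finitely generated (as an additive monoid). (b) $\mathbb{N}_0[\alpha]$ has finitely many Betti elements.
   Context: $\mathbb{N}_0$ is the set of nonnegative integers. For a positive real $\alpha$, $\mathbb{N}_0[\alpha] = \{p(\alpha) \mid p(X) \in \mathbb{N}_0[X]\}$, where $\mathbb{N}_0[X]$ is the set of polynomials with nonnegative integer coefficients; it is regarded as a monoid under addition. Algebraic means algebraic over $\mathbb{Q}$. An atom of $M = \mathbb{N}_0[\alpha]$ is a nonzero element that is not the sum of two nonzero elements of $M$. $M$ is atomic if every nonzero element is a sum of finitely many atoms. A factorization of $b \in M$ is a formal sum (finite multiset) of atoms of $M$ whose actual sum is $b$; $\mathsf{Z}(b)$ denotes the set of all factorizations of $b$. For factorizations $z = \sum_a \mu_a a$ and $z' = \sum_a \nu_a a$ (formal sums over atoms), $\gcd(z,z') = \sum_a \min\{\mu_a, \nu_a\} a$. The Betti graph $\nabla_b$ of $b \in M$ is the graph with vertex set $\mathsf{Z}(b)$ having an edge between $z$ and $z'$ if and only if $\gcd(z,z') \neq 0$ (that is, $z$ and $z'$ share an atom). An element $b \in M$ is a Betti element of $M$ if $\nabla_b$ is disconnected. *)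

theory Defs
  imports
    "HOL-Library.Multiset"
    "HOL-Computational_Algebra.Polynomial"
    "Graph_Theory.Digraph_Component"
begin

definition nat_poly_monoid :: "real \<Rightarrow> real set" where
  "nat_poly_monoid \<alpha> = {poly (map_poly of_nat p) \<alpha> | p :: nat poly. True}"

text \<open>
  Below, a commutative monoid is a subset \<open>M\<close> of an ambient type of class
  \<open>comm_monoid_add\<close> which is closed under addition and contains \<open>0\<close>.
\<close>

definition additive_submonoid :: "'a::comm_monoid_add set \<Rightarrow> bool" where
  "additive_submonoid N \<longleftrightarrow> 0 \<in> N \<and> (\<forall>x\<in>N. \<forall>y\<in>N. x + y \<in> N)"

definition finitely_generated :: "'a::comm_monoid_add set \<Rightarrow> bool" where
  "finitely_generated M \<longleftrightarrow> (\<exists>S. finite S \<and> S \<subseteq> M \<and> M = additive_submonoid hull S)"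

definition atoms :: "'a::comm_monoid_add set \<Rightarrow> 'a set" where
  "atoms M = {a \<in> M. a \<noteq> 0 \<and> \<not> (\<exists>x\<in>M. \<exists>y\<in>M. x \<noteq> 0 \<and> y \<noteq> 0 \<and> a = x + y)}"

definition factorizations :: "'a::comm_monoid_add set \<Rightarrow> 'a \<Rightarrow> 'a multiset set" where
  "factorizations M b = {z. set_mset z \<subseteq> atoms M \<and> sum_mset z = b}"

definition atomic :: "'a::comm_monoid_add set \<Rightarrow> bool" where
  "atomic M \<longleftrightarrow> (\<forall>b\<in>M. b \<noteq> 0 \<longrightarrow> (\<exists>z. set_mset z \<subseteq> atoms M \<and> sum_mset z = b))"

text \<open>
  An undirected edge is represented by the two arcs between its end points; there are no
  loops. The multiset intersection \<open>\<inter>#\<close> takes the minimum of the multiplicities, i.e. it is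
  the gcd of two factorizations.
\<close>

definition betti_graph ::
  "'a::comm_monoid_add set \<Rightarrow> 'a \<Rightarrow> ('a multiset, 'a multiset \<times> 'a multiset) pre_digraph" where
  "betti_graph M b =
     \<lparr> verts = factorizations M b,
       arcs = {(z, z'). z \<in> factorizations M b \<and> z' \<in> factorizations M b \<and>
                        z \<noteq> z' \<and> z \<inter># z' \<noteq> {#}},
       tail = fst, head = snd \<rparr>"

text \<open>
  \<open>Digraph_Component.connected\<close> (not the topological notion of the same short name) is false
  for the graph without vertices. In an atomic \<open>M\<close> no Betti graph of an element of \<open>M\<close> is
  empty, as \<open>{#}\<close> is a factorization of \<open>0\<close>; so this convention plays no role there.
\<close>

definition betti_element :: "'a::comm_monoid_add set \<Rightarrow> 'a \<Rightarrow> bool" where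
  "betti_element M b \<longleftrightarrow> b \<in> M \<and> \<not> Digraph_Component.connected (betti_graph M b)"

end

theory Submission
  imports Defs
begin

text \<open>
  If the monoid is generated by finitely many atoms, choose for each Betti element \<open>b \<noteq> 0\<close> two
  factorizations in different components of its graph. By Dickson's lemma infinitely many Betti
  elements would yield \<open>b \<noteq> b'\<close> whose pairs \<open>(z, y)\<close> and \<open>(z', y')\<close> satisfy
  \<open>z' = z + w\<close> and \<open>y' = y + v\<close>; but then
  \<open>z + w\<close>, \<open>y + w\<close>, \<open>y + v\<close> is a path from \<open>z'\<close> to \<open>y'\<close>.

  Conversely, if \<open>\<nat>\<^sub>0[\<alpha>]\<close> is atomic and not finitely generated, its atoms are exactly the powers
  of \<open>\<alpha>\<close>, and these are pairwise distinct. For each \<open>N\<close> take a factorization \<open>z\<close> of minimal size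
  among those which involve only powers \<open>\<alpha>\<^sup>i\<close> with \<open>i \<ge> N\<close> and whose sum has another
  factorization. A common atom could be cancelled, so \<open>z\<close> is an isolated vertex and its sum
  \<open>b\<close> is a Betti element. An algebraic relation multiplied by \<open>\<alpha>\<^sup>N\<close> bounds the size of \<open>z\<close> by
  some \<open>s\<close> independent of \<open>N\<close>. So \<open>b \<ge> \<alpha>\<^sup>N\<close> if \<open>\<alpha> > 1\<close>, and \<open>0 < b \<le> s \<alpha>\<^sup>N\<close> if \<open>\<alpha> < 1\<close>;
  in both cases infinitely many \<open>b\<close> occur.
\<close>

section \<open>Submonoids, generators and atoms\<close>

lemma submonoid_hull_eq:
  "additive_submonoid hull S = {sum_mset z | z. set_mset z \<subseteq> S}"
proof (rule hull_unique)
  show "S \<subseteq> {sum_mset z | z. set_mset z \<subseteq> S}"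
  proof
    fix x assume "x \<in> S"
    then show "x \<in> {sum_mset z | z. set_mset z \<subseteq> S}"
      by (intro CollectI exI[of _ "{#x#}"]) auto
  qed
  show "additive_submonoid {sum_mset z | z. set_mset z \<subseteq> S}"
    unfolding additive_submonoid_def
  proof (intro conjI ballI)
    show "0 \<in> {sum_mset z | z. set_mset z \<subseteq> S}"
      by (intro CollectI exI[of _ "{#}"]) auto
    fix x y assume "x \<in> {sum_mset z | z. set_mset z \<subseteq> S}" "y \<in> {sum_mset z | z. set_mset z \<subseteq> S}"
    then obtain u v where "x = sum_mset u" "set_mset u \<subseteq> S" "y = sum_mset v" "set_mset v \<subseteq> S"
      by blast
    then show "x + y \<in> {sum_mset z | z. set_mset z \<subseteq> S}"
      by (intro CollectI exI[of _ "u + v"]) auto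
  qed
  fix T assume T: "S \<subseteq> T" "additive_submonoid T"
  have "sum_mset z \<in> T" if "set_mset z \<subseteq> S" for z
    using that
  proof (induction z)
    case empty
    then show ?case using T(2) by (simp add: additive_submonoid_def)
  next
    case (add x z)
    then show ?case using T by (auto simp: additive_submonoid_def)
  qed
  then show "{sum_mset z | z. set_mset z \<subseteq> S} \<subseteq> T" by blast
qed

lemma additive_submonoid_hull: "additive_submonoid (additive_submonoid hull S)"
  by (rule hull_in) (auto simp: additive_submonoid_def)

lemma sum_mset_in_submonoid:
  assumes "additive_submonoid M" "set_mset z \<subseteq> M"
  shows "sum_mset z \<in> M"
  using assms submonoid_hull_eq[of M] hull_same[of additive_submonoid M] by blast

text \<open>Split one generator off a sum of generators that is an atom: either the generator or the
  rest is 0. Dropping the zero part leaves a single generator or a shorter sum, so induction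
  applies.\<close>

lemma atoms_subset_generators: "atoms (additive_submonoid hull S) \<subseteq> S"
proof
  let ?M = "additive_submonoid hull S"
  fix a assume a: "a \<in> atoms ?M"
  then obtain z where z: "set_mset z \<subseteq> S" "a = sum_mset z"
    by (auto simp: atoms_def submonoid_hull_eq)
  have "sum_mset z \<in> S" if "set_mset z \<subseteq> S" "sum_mset z \<in> atoms ?M" for z
    using that
  proof (induction z)
    case empty
    then show ?case by (simp add: atoms_def)
  next
    case (add x z)
    have "x \<in> ?M" using add.prems(1) by (simp add: hull_inc)
    moreover have "sum_mset z \<in> ?M" using add.prems(1) by (auto simp: submonoid_hull_eq)
    ultimately have "x = 0 \<or> sum_mset z = 0"
      using add.prems(2) by (auto simp: atoms_def)
    then show ?case using add by auto
  qed
  then show "a \<in> S" using a z by blast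
qed

lemma atomic_imp_hull_atoms:
  assumes "additive_submonoid M" "atomic M"
  shows "M = additive_submonoid hull (atoms M)"
proof
  show "additive_submonoid hull (atoms M) \<subseteq> M"
    by (rule hull_minimal) (use assms(1) in \<open>auto simp: atoms_def\<close>)
  show "M \<subseteq> additive_submonoid hull (atoms M)"
  proof
    fix b assume b: "b \<in> M"
    show "b \<in> additive_submonoid hull (atoms M)"
    proof (cases "b = 0")
      case True
      then show ?thesis
        using additive_submonoid_hull[of "atoms M"] by (simp add: additive_submonoid_def)
    next
      case False
      then show ?thesis
        using assms(2) b unfolding atomic_def submonoid_hull_eq by blast
    qed
  qed
qed

text \<open>Every generating set contains all atoms, and in an atomic monoid the atoms themselves
  generate.\<close>

lemma atomic_finitely_generated_iff:
  assumes "additive_submonoid M" "atomic M"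
  shows "finitely_generated M \<longleftrightarrow> finite (atoms M)"
proof
  assume "finitely_generated M"
  then show "finite (atoms M)"
    unfolding finitely_generated_def using atoms_subset_generators finite_subset by metis
next
  assume "finite (atoms M)"
  then show "finitely_generated M"
    unfolding finitely_generated_def using atomic_imp_hull_atoms[OF assms]
    by (intro exI[of _ "atoms M"]) (auto simp: atoms_def)
qed

lemma atomic_factorizations_nonempty:
  assumes "atomic M" "b \<in> M"
  shows "factorizations M b \<noteq> {}"
proof (cases "b = 0")
  case True
  then have "{#} \<in> factorizations M b" by (simp add: factorizations_def)
  then show ?thesis by blast
next
  case False
  then show ?thesis using assms by (auto simp: atomic_def factorizations_def)
qed

section \<open>Betti graphs\<close>

lemma pverts_mk_symmetric_betti_graph:
  "pverts (mk_symmetric (betti_graph M b)) = factorizations M b"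
  by (simp add: mk_symmetric_def betti_graph_def)

text \<open>Sharing an atom is a symmetric relation, so the symmetric closure built into
  \<open>connected\<close> adds no arcs.\<close>

lemma parcs_mk_symmetric_betti_graph:
  fixes M :: "'a::comm_monoid_add set"
  shows "parcs (mk_symmetric (betti_graph M b)) =
     {(z, z'). z \<in> factorizations M b \<and> z' \<in> factorizations M b \<and> z \<noteq> z' \<and> z \<inter># z' \<noteq> {#}}"
  (is "_ = ?E")
proof -
  have "(v, u) \<in> ?E" if "(u, v) \<in> ?E" for u v
    using that subset_mset.inf_commute[of u v] by auto
  moreover have "(\<Union>e\<in>R. {(fst e, snd e), (snd e, fst e)}) = R"
    if "\<And>u v. (u, v) \<in> R \<Longrightarrow> (v, u) \<in> R" for R :: "('a multiset \<times> 'a multiset) set"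
    using that by force
  ultimately have "(\<Union>e\<in>?E. {(fst e, snd e), (snd e, fst e)}) = ?E" by presburger
  then show ?thesis by (simp only: mk_symmetric_def betti_graph_def pair_pre_digraph.simps pre_digraph.simps)
qed

text \<open>Connectedness asks for a vertex as well as for walks. Atomicity supplies the vertex, so
  it can fail only through two factorizations with no walk between them.\<close>

lemma betti_element_iff:
  assumes "atomic M"
  shows "betti_element M b \<longleftrightarrow> b \<in> M \<and>
    (\<exists>z\<in>factorizations M b. \<exists>z'\<in>factorizations M b.
      (z, z') \<notin> rtrancl_on (factorizations M b)
        {(u, v). u \<in> factorizations M b \<and> v \<in> factorizations M b \<and> u \<noteq> v \<and> u \<inter># v \<noteq> {#}})"
proof (cases "b \<in> M")
  case True
  then show ?thesis
    using atomic_factorizations_nonempty[OF assms True]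
    unfolding betti_element_def Digraph_Component.connected_def strongly_connected_def
      reachable_def with_proj_simps pverts_mk_symmetric_betti_graph parcs_mk_symmetric_betti_graph
    by meson
next
  case False
  then show ?thesis by (simp add: betti_element_def)
qed

text \<open>A walk that starts at an isolated vertex never leaves it, so a second vertex is out of
  reach.\<close>

lemma betti_element_if_isolated:
  assumes "atomic M" "b \<in> M" "z \<in> factorizations M b" "z' \<in> factorizations M b" "z \<noteq> z'"
    and isolated: "\<And>u. u \<in> factorizations M b \<Longrightarrow> u \<noteq> z \<Longrightarrow> z \<inter># u = {#}"
  shows "betti_element M b"
proof -
  let ?E = "{(u, v). u \<in> factorizations M b \<and> v \<in> factorizations M b \<and> u \<noteq> v \<and> u \<inter># v \<noteq> {#}}"
  have "y = z" if "(z, y) \<in> rtrancl_on (factorizations M b) ?E" for y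
    using that
  proof (induction rule: rtrancl_on_induct)
    case base
    show ?case by simp
  next
    case (step u v)
    then show ?case using isolated[of v] by (metis (mono_tags, lifting) case_prodD mem_Collect_eq)
  qed
  then have "(z, z') \<notin> rtrancl_on (factorizations M b) ?E" using assms(5) by blast
  then show ?thesis
    unfolding betti_element_iff[OF assms(1)]
    by (intro conjI bexI[of _ z] bexI[of _ z'] assms(2-4))
qed

section \<open>Dickson's lemma\<close>

lemma nat_seq_mono_subseq:
  fixes f :: "nat \<Rightarrow> nat"
  obtains r :: "nat \<Rightarrow> nat" where "strict_mono r" "mono (\<lambda>n. f (r n))"
proof -
  obtain r :: "nat \<Rightarrow> nat" where r: "strict_mono r" "monoseq (\<lambda>n. f (r n))"
    using seq_monosub[of f] by blast
  show thesis
  proof (cases "incseq (\<lambda>n. f (r n))")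
    case True
    then show thesis using r(1) that by blast
  next
    case False
    then have dec: "decseq (\<lambda>n. f (r n))" using r(2) by (auto simp: monoseq_iff)
    \<comment> \<open>A decreasing sequence of naturals is constant from the place where it attains
      its least value, and a constant sequence is monotone.\<close>
    obtain n0 where n0: "\<And>n. f (r n0) \<le> f (r n)"
      using ex_has_least_nat[of "\<lambda>_. True" _ "\<lambda>n. f (r n)"] by auto
    have const: "f (r (n + n0)) = f (r n0)" for n
      using n0[of "n + n0"] dec[unfolded decseq_def, rule_format, of n0 "n + n0"] by simp
    show thesis
    proof (rule that[of "\<lambda>n. r (n + n0)"])
      show "strict_mono (\<lambda>n. r (n + n0))"
        using r(1) by (simp add: strict_mono_def)
      show "mono (\<lambda>n. f (r (n + n0)))" by (simp add: const mono_def)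
    qed
  qed
qed

text \<open>Thin out for one index at a time; monotonicity already achieved survives passing to a
  further subsequence.\<close>

lemma nat_seqs_mono_subseq:
  fixes f :: "'i \<Rightarrow> nat \<Rightarrow> nat"
  assumes "finite I"
  shows "\<exists>r :: nat \<Rightarrow> nat. strict_mono r \<and> (\<forall>i\<in>I. mono (\<lambda>n. f i (r n)))"
  using assms
proof (induction I)
  case empty
  show ?case by (intro exI[of _ id]) (simp add: strict_mono_def)
next
  case (insert j I)
  then obtain r :: "nat \<Rightarrow> nat" where r: "strict_mono r" "\<And>i. i \<in> I \<Longrightarrow> mono (\<lambda>n. f i (r n))" by blast
  obtain q :: "nat \<Rightarrow> nat" where q: "strict_mono q" "mono (\<lambda>n. f j (r (q n)))"
    using nat_seq_mono_subseq[of "\<lambda>n. f j (r n)"] by blast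
  have "mono (\<lambda>n. f i (r (q n)))" if "i \<in> I" for i
    using r(2)[OF that] strict_mono_mono[OF q(1)] by (simp add: mono_def)
  moreover have "strict_mono (\<lambda>n. r (q n))"
    using r(1) q(1) by (simp add: strict_mono_def)
  ultimately show ?case using q(2) by (intro exI[of _ "\<lambda>n. r (q n)"]) auto
qed

lemma Dickson_mset_pairs:
  fixes f g :: "nat \<Rightarrow> 'a multiset"
  assumes "finite A" "\<And>n. set_mset (f n) \<subseteq> A" "\<And>n. set_mset (g n) \<subseteq> A"
  obtains m n where "m < n" "f m \<subseteq># f n" "g m \<subseteq># g n"
proof -
  \<comment> \<open>The multiplicities in \<open>f\<close> and \<open>g\<close> form one finite
    family over \<open>A <+> A\<close>, so a single subsequence serves both.\<close>
  define h where "h = case_sum (\<lambda>a n. count (f n) a) (\<lambda>a n. count (g n) a)"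
  obtain r :: "nat \<Rightarrow> nat" where r: "strict_mono r" "\<forall>i \<in> A <+> A. mono (\<lambda>n. h i (r n))"
    using nat_seqs_mono_subseq[OF finite_Plus[OF assms(1) assms(1)], of h] by blast
  have f: "count (f (r 0)) a \<le> count (f (r 1)) a" for a
  proof (cases "a \<in> A")
    case True
    then have "mono (\<lambda>n. h (Inl a) (r n))" using r(2) by blast
    then show ?thesis by (auto simp: h_def dest: monoD[of _ 0 1])
  next
    case False
    then have "a \<notin># f (r 0)" using assms(2) by blast
    then show ?thesis by (simp add: not_in_iff)
  qed
  have g: "count (g (r 0)) a \<le> count (g (r 1)) a" for a
  proof (cases "a \<in> A")
    case True
    then have "mono (\<lambda>n. h (Inr a) (r n))" using r(2) by blast
    then show ?thesis by (auto simp: h_def dest: monoD[of _ 0 1])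
  next
    case False
    then have "a \<notin># g (r 0)" using assms(3) by blast
    then show ?thesis by (simp add: not_in_iff)
  qed
  show thesis
    by (rule that[of "r 0" "r 1"]) (use r(1) f g in \<open>auto simp: strict_mono_def subseteq_mset_def\<close>)
qed

section \<open>Finitely many atoms give finitely many Betti elements\<close>

lemma finite_betti_elements:
  fixes M :: "'a::comm_monoid_add set"
  assumes "atomic M" "finite (atoms M)"
  shows "finite {b. betti_element M b}"
proof (rule ccontr)
  assume "infinite {b. betti_element M b}"
  \<comment> \<open>Removing 0 ensures below that \<open>g m\<close> is nonempty.\<close>
  then have "infinite ({b. betti_element M b} - {0})" by simp
  then obtain b :: "nat \<Rightarrow> 'a"
    where b: "inj b" "range b \<subseteq> {b. betti_element M b} - {0}"
    using infinite_countable_subset by blast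
  let ?E = "\<lambda>b. {(u, v). u \<in> factorizations M b \<and> v \<in> factorizations M b \<and> u \<noteq> v \<and> u \<inter># v \<noteq> {#}}"
  let ?R = "\<lambda>b. rtrancl_on (factorizations M b) (?E b)"
  define D where "D = (\<lambda>n z z'. z \<in> factorizations M (b n) \<and> z' \<in> factorizations M (b n) \<and>
      (z, z') \<notin> ?R (b n))"
  have "\<exists>z z'. D n z z'" for n
  proof -
    have "betti_element M (b n)" using b(2) by blast
    then show ?thesis
      unfolding betti_element_iff[OF assms(1)] D_def by blast
  qed
  then obtain f g where "\<And>n. D n (f n) (g n)" by metis
  then have fg: "f n \<in> factorizations M (b n)" "g n \<in> factorizations M (b n)"
      "(f n, g n) \<notin> ?R (b n)" for n
    by (simp_all only: D_def simp_thms)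
  obtain m n where mn: "m < n" "f m \<subseteq># f n" "g m \<subseteq># g n"
    by (rule Dickson_mset_pairs[of "atoms M" f g])
      (use assms(2) fg in \<open>auto simp: factorizations_def\<close>)
  obtain w where w: "f n = f m + w" using mn(2) by (auto simp: mset_subset_eq_exists_conv)
  obtain v where v: "g n = g m + v" using mn(3) by (auto simp: mset_subset_eq_exists_conv)
  have sums: "sum_mset (f m) = b m" "sum_mset (g m) = b m" "sum_mset (f n) = b n"
    using fg by (auto simp: factorizations_def)
  have "b m \<noteq> b n" using b(1) mn(1) by (auto dest: injD)
  then have "w \<noteq> {#}" using sums w by auto
  have "b m \<noteq> 0" using b(2) by blast
  then have "g m \<noteq> {#}" using sums by auto
  \<comment> \<open>Since \<open>f m\<close> and \<open>g m\<close> have the same sum, exchanging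
    them inside \<open>f n = f m + w\<close> keeps the sum \<open>b n\<close>.\<close>
  have mid: "g m + w \<in> factorizations M (b n)"
    using fg(1)[of n] fg(2)[of m] sums w by (auto simp: factorizations_def)
  \<comment> \<open>A common nonempty part gives an edge. Equal vertices need the trivial walk
    instead, because the graph has no loops.\<close>
  have step: "(x, y) \<in> ?R (b n)"
    if "x \<in> factorizations M (b n)" "y \<in> factorizations M (b n)" "u \<noteq> {#}" "u \<subseteq># x" "u \<subseteq># y" for x y u
  proof (cases "x = y")
    case True
    then show ?thesis using that by auto
  next
    case False
    have "u \<subseteq># x \<inter># y" using that(4,5) by (rule subset_mset.inf_greatest)
    then have "x \<inter># y \<noteq> {#}" using that(3) subset_mset.le_zero_eq by fastforce
    then have "(x, y) \<in> ?E (b n)" using that False by auto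
    then show ?thesis using that(1,2) by (blast intro: rtrancl_on_into_rtrancl_on)
  qed
  have "(f n, g m + w) \<in> ?R (b n)"
    using step[OF fg(1) mid \<open>w \<noteq> {#}\<close>] w by simp
  moreover have "(g m + w, g n) \<in> ?R (b n)"
    using step[OF mid fg(2) \<open>g m \<noteq> {#}\<close>] v by simp
  ultimately have "(f n, g n) \<in> ?R (b n)" by (rule rtrancl_on_trans)
  then show False by (rule notE[OF fg(3)])
qed

section \<open>The monoid of a positive real\<close>

text \<open>Bridge from polynomials to formal sums: the coefficient at \<open>i\<close> becomes that
  many copies of \<open>\<alpha> ^ i\<close>.\<close>

lemma sum_mset_sum_replicate_mset:
  fixes f :: "nat \<Rightarrow> nat" and \<alpha> :: "'a::comm_semiring_1"
  shows "sum_mset (\<Sum>i\<in>I. replicate_mset (f i) (\<alpha> ^ i)) = (\<Sum>i\<in>I. of_nat (f i) * \<alpha> ^ i)"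
  by (induction I rule: infinite_finite_induct) auto

lemma set_mset_sum_replicate_mset:
  "set_mset (\<Sum>i\<in>I. replicate_mset (f i) (\<alpha> ^ i)) \<subseteq> range (\<lambda>i. \<alpha> ^ i)"
  by (induction I rule: infinite_finite_induct) (auto split: if_splits)

lemma nat_poly_monoid_eq_hull:
  "nat_poly_monoid \<alpha> = additive_submonoid hull (range (\<lambda>i. \<alpha> ^ i))"
proof
  show "nat_poly_monoid \<alpha> \<subseteq> additive_submonoid hull (range (\<lambda>i. \<alpha> ^ i))"
  proof
    fix x assume "x \<in> nat_poly_monoid \<alpha>"
    then obtain p :: "nat poly" where p: "x = poly (map_poly of_nat p) \<alpha>"
      by (auto simp: nat_poly_monoid_def)
    have "degree (map_poly (of_nat :: nat \<Rightarrow> real) p) = degree p"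
      by (rule degree_map_poly) auto
    then have "x = sum_mset (\<Sum>i\<le>degree p. replicate_mset (coeff p i) (\<alpha> ^ i))"
      by (simp add: p poly_altdef coeff_map_poly sum_mset_sum_replicate_mset)
    then show "x \<in> additive_submonoid hull (range (\<lambda>i. \<alpha> ^ i))"
      unfolding submonoid_hull_eq using set_mset_sum_replicate_mset by blast
  qed
  have "additive_submonoid (nat_poly_monoid \<alpha>)"
    unfolding additive_submonoid_def
  proof (intro conjI ballI)
    show "0 \<in> nat_poly_monoid \<alpha>"
      unfolding nat_poly_monoid_def by (intro CollectI exI[of _ 0]) simp
    fix x y assume "x \<in> nat_poly_monoid \<alpha>" "y \<in> nat_poly_monoid \<alpha>"
    then obtain p q :: "nat poly"
      where "x = poly (map_poly of_nat p) \<alpha>" "y = poly (map_poly of_nat q) \<alpha>"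
      by (auto simp: nat_poly_monoid_def)
    moreover have "map_poly (of_nat :: nat \<Rightarrow> real) (p + q) = map_poly of_nat p + map_poly of_nat q"
      by (rule poly_eqI) (simp add: coeff_map_poly)
    ultimately show "x + y \<in> nat_poly_monoid \<alpha>"
      unfolding nat_poly_monoid_def by (intro CollectI exI[of _ "p + q"]) simp
  qed
  moreover have "range (\<lambda>i. \<alpha> ^ i) \<subseteq> nat_poly_monoid \<alpha>"
  proof
    fix x assume "x \<in> range (\<lambda>i. \<alpha> ^ i)"
    then obtain i where "x = \<alpha> ^ i" by blast
    then show "x \<in> nat_poly_monoid \<alpha>"
      unfolding nat_poly_monoid_def
      by (intro CollectI exI[of _ "monom 1 i"]) (simp add: map_poly_monom poly_monom)
  qed
  ultimately show "additive_submonoid hull (range (\<lambda>i. \<alpha> ^ i)) \<subseteq> nat_poly_monoid \<alpha>"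
    by (intro hull_minimal)
qed

lemma additive_submonoid_nat_poly_monoid: "additive_submonoid (nat_poly_monoid \<alpha>)"
  by (simp add: nat_poly_monoid_eq_hull additive_submonoid_hull)

text \<open>Multiplication by \<open>\<alpha> ^ n\<close> shifts exponents, so it sends sums of
  powers to sums of powers.\<close>

lemma power_mult_in_nat_poly_monoid:
  assumes "x \<in> nat_poly_monoid \<alpha>"
  shows "\<alpha> ^ n * x \<in> nat_poly_monoid \<alpha>"
proof -
  obtain z where z: "set_mset z \<subseteq> range (\<lambda>i. \<alpha> ^ i)" "x = sum_mset z"
    using assms by (auto simp: nat_poly_monoid_eq_hull submonoid_hull_eq)
  have "\<alpha> ^ n * x = sum_mset (image_mset ((*) (\<alpha> ^ n)) z)"
    using sum_mset_distrib_left[of "\<alpha> ^ n" "\<lambda>x. x" z] by (simp add: z(2))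
  moreover have "set_mset (image_mset ((*) (\<alpha> ^ n)) z) \<subseteq> range (\<lambda>i. \<alpha> ^ i)"
    using z(1) by (auto simp: subset_iff image_iff) (metis power_add)
  ultimately show ?thesis
    unfolding nat_poly_monoid_eq_hull submonoid_hull_eq by blast
qed

lemma atoms_nat_poly_monoid_subset: "atoms (nat_poly_monoid \<alpha>) \<subseteq> range (\<lambda>i. \<alpha> ^ i)"
  unfolding nat_poly_monoid_eq_hull by (rule atoms_subset_generators)

text \<open>If \<open>\<alpha> ^ k\<close> decomposes, multiplying by
  \<open>\<alpha> ^ (n - k)\<close> decomposes every \<open>\<alpha> ^ n\<close> with
  \<open>n \<ge> k\<close>. Then only the finitely many powers below \<open>k\<close> could be
  atoms.\<close>

lemma infinite_atoms_nat_poly_monoid: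
  assumes "\<alpha> > 0" "infinite (atoms (nat_poly_monoid \<alpha>))"
  shows "atoms (nat_poly_monoid \<alpha>) = range (\<lambda>i. \<alpha> ^ i)"
proof (rule ccontr)
  let ?M = "nat_poly_monoid \<alpha>"
  assume "atoms ?M \<noteq> range (\<lambda>i. \<alpha> ^ i)"
  then obtain k where k: "\<alpha> ^ k \<notin> atoms ?M"
    using atoms_nat_poly_monoid_subset by blast
  have mem: "\<alpha> ^ i \<in> ?M" for i
    by (simp add: nat_poly_monoid_eq_hull hull_inc)
  then obtain x y where xy: "x \<in> ?M" "y \<in> ?M" "x \<noteq> 0" "y \<noteq> 0" "\<alpha> ^ k = x + y"
    using k assms(1) by (auto simp: atoms_def)
  have "\<alpha> ^ n \<notin> atoms ?M" if "n \<ge> k" for n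
  proof -
    have "\<alpha> ^ n = \<alpha> ^ (n - k) * x + \<alpha> ^ (n - k) * y"
      using that by (simp flip: xy(5) distrib_left power_add)
    moreover have "\<alpha> ^ (n - k) * x \<noteq> 0" "\<alpha> ^ (n - k) * y \<noteq> 0"
      using xy assms(1) by auto
    ultimately show ?thesis
      using power_mult_in_nat_poly_monoid xy(1,2) unfolding atoms_def by blast
  qed
  then have "atoms ?M \<subseteq> (\<lambda>i. \<alpha> ^ i) ` {..<k}"
    using atoms_nat_poly_monoid_subset[of \<alpha>] by (force simp flip: not_le)
  then show False using assms(2) finite_subset by blast
qed

lemma count_sum_replicate_mset_powers:
  assumes "inj (\<lambda>i. \<alpha> ^ i)" "finite I" "j \<in> I"
  shows "count (\<Sum>i\<in>I. replicate_mset (f i) (\<alpha> ^ i)) (\<alpha> ^ j) = f j"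
proof -
  have eq: "\<alpha> ^ j = \<alpha> ^ i \<longleftrightarrow> j = i" for i using assms(1) by (auto dest: injD)
  show ?thesis using assms(2,3) by (simp add: count_sum eq)
qed

text \<open>Move the negative terms of an integer polynomial relation for \<open>\<alpha>\<close> to
  the other side; both sides are then formal sums of powers.\<close>

lemma algebraic_two_factorizations:
  fixes \<alpha> :: real
  assumes "algebraic \<alpha>" "inj (\<lambda>i. \<alpha> ^ i)"
  obtains z z' where "z \<noteq> z'" "sum_mset z = sum_mset z'"
    "set_mset z \<subseteq> range (\<lambda>i. \<alpha> ^ i)" "set_mset z' \<subseteq> range (\<lambda>i. \<alpha> ^ i)"
proof -
  obtain p where p: "p \<noteq> 0" "poly (map_poly of_int p) \<alpha> = 0"
    using assms(1) by (rule algebraicE')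
  define S where "S = (\<lambda>f :: nat \<Rightarrow> nat. \<Sum>i\<le>degree p. replicate_mset (f i) (\<alpha> ^ i))"
  \<comment> \<open>\<open>nat\<close> sends negative integers to 0, so \<open>P\<close> and
    \<open>Q\<close> are the positive and negative parts of the coefficients.\<close>
  define P where "P = (\<lambda>i. nat (coeff p i))"
  define Q where "Q = (\<lambda>i. nat (- coeff p i))"
  have "degree (map_poly (of_int :: int \<Rightarrow> real) p) = degree p"
    by (rule degree_map_poly) auto
  then have "(\<Sum>i\<le>degree p. of_int (coeff p i) * \<alpha> ^ i) = 0"
    using p(2) by (simp add: poly_altdef coeff_map_poly)
  moreover have "of_int (coeff p i) = real (P i) - real (Q i)" for i
    by (simp add: P_def Q_def)
  ultimately have "sum_mset (S P) = sum_mset (S Q)"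
    by (simp add: S_def sum_mset_sum_replicate_mset left_diff_distrib sum_subtractf)
  moreover have "S P \<noteq> S Q"
  proof
    assume "S P = S Q"
    moreover have "count (S f) (\<alpha> ^ degree p) = f (degree p)" for f
      unfolding S_def by (rule count_sum_replicate_mset_powers[OF assms(2)]) auto
    \<comment> \<open>The leading coefficient is nonzero, so exactly one of its two parts
      vanishes.\<close>
    ultimately have "P (degree p) = Q (degree p)" by metis
    then show False using p(1) by (auto simp: P_def Q_def nat_eq_iff split: if_splits)
  qed
  ultimately show thesis
    using that[of "S P" "S Q"] set_mset_sum_replicate_mset unfolding S_def by blast
qed

lemma sum_mset_le_size_mult:
  fixes c :: "'a::linordered_semidom"
  assumes "\<And>x. x \<in># z \<Longrightarrow> x \<le> c"
  shows "sum_mset z \<le> of_nat (size z) * c"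
  using assms by (induction z) (auto simp: distrib_right intro: add_mono)

lemma minimal_factorization_betti_element:
  fixes \<alpha> :: real
  assumes "\<alpha> > 0" "atomic (nat_poly_monoid \<alpha>)"
    and atoms: "atoms (nat_poly_monoid \<alpha>) = range (\<lambda>i. \<alpha> ^ i)"
    and z0: "set_mset z0 \<subseteq> (\<lambda>i. \<alpha> ^ i) ` {N..}" "set_mset z0' \<subseteq> range (\<lambda>i. \<alpha> ^ i)"
      "sum_mset z0 = sum_mset z0'" "z0 \<noteq> z0'"
  obtains z where "set_mset z \<subseteq> (\<lambda>i. \<alpha> ^ i) ` {N..}" "z \<noteq> {#}" "size z \<le> size z0"
    "betti_element (nat_poly_monoid \<alpha>) (sum_mset z)"
proof -
  let ?M = "nat_poly_monoid \<alpha>"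
  \<comment> \<open>Only \<open>z\<close> is confined to exponents from \<open>N\<close> on; the
    competing \<open>z'\<close> may use any power, as the Betti graph of the sum contains all
    factorizations.\<close>
  define T where "T = (\<lambda>z. set_mset z \<subseteq> (\<lambda>i. \<alpha> ^ i) ` {N..} \<and>
    (\<exists>z'. set_mset z' \<subseteq> atoms ?M \<and> sum_mset z = sum_mset z' \<and> z \<noteq> z'))"
  have "T z0" using z0 atoms unfolding T_def by blast
  then obtain z where z: "T z" and min: "\<And>u. T u \<Longrightarrow> size z \<le> size u"
    using ex_has_least_nat[of T z0 size] by blast
  from z have zN: "set_mset z \<subseteq> (\<lambda>i. \<alpha> ^ i) ` {N..}" by (simp add: T_def)
  from z obtain z' where z': "set_mset z' \<subseteq> atoms ?M" "sum_mset z = sum_mset z'" "z \<noteq> z'"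
    by (auto simp: T_def)
  have z_atoms: "set_mset z \<subseteq> atoms ?M" using zN atoms by blast
  have pos: "sum_mset u > 0" if "set_mset u \<subseteq> atoms ?M" "u \<noteq> {#}" for u
  proof -
    have "\<forall>x\<in>#u. x > 0" using that(1) atoms assms(1) by auto
    then show ?thesis using that(2)
    proof (induction u)
      case (add x u)
      then show ?case by (cases "u = {#}") (auto intro: add_pos_pos)
    qed simp
  qed
  \<comment> \<open>Otherwise \<open>z'\<close> would be a nonempty multiset of positive atoms with
    sum 0.\<close>
  have "z \<noteq> {#}"
    using pos[OF z'(1)] z'(2,3) by (metis less_irrefl sum_mset.empty)
  have "z \<inter># u = {#}" if u: "u \<in> factorizations ?M (sum_mset z)" "u \<noteq> z" for u
  proof (rule ccontr)
    assume "z \<inter># u \<noteq> {#}"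
    then obtain a where "a \<in># z" "a \<in># u" 
      by (metis multiset_nonemptyE Int_iff set_mset_inter)
    then obtain v w where vw: "z = add_mset a v" "u = add_mset a w"
      by (metis multi_member_split)
    \<comment> \<open>Cancelling the common atom \<open>a\<close> leaves distinct \<open>v\<close>
      and \<open>w\<close> with equal sums, and \<open>v\<close> is smaller than the minimal
      \<open>z\<close>.\<close>
    then have "T v"
      using zN u unfolding T_def by (auto simp: factorizations_def)
    then show False using min[of v] vw(1) by simp
  qed
  moreover have "sum_mset z \<in> ?M"
    by (rule sum_mset_in_submonoid[OF additive_submonoid_nat_poly_monoid])
      (use z_atoms in \<open>auto simp: atoms_def\<close>)
  ultimately have "betti_element ?M (sum_mset z)"
    using betti_element_if_isolated[OF assms(2), of "sum_mset z" z z'] z' z_atoms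
    by (auto simp: factorizations_def)
  then show thesis by (rule that[OF zN \<open>z \<noteq> {#}\<close> min[OF \<open>T z0\<close>]])
qed

lemma infinite_betti_elements:
  fixes \<alpha> :: real
  assumes "\<alpha> > 0" "algebraic \<alpha>" "atomic (nat_poly_monoid \<alpha>)"
    and "infinite (atoms (nat_poly_monoid \<alpha>))"
  shows "infinite {b. betti_element (nat_poly_monoid \<alpha>) b}" (is "infinite ?B")
proof
  assume fin: "finite ?B"
  have atoms: "atoms (nat_poly_monoid \<alpha>) = range (\<lambda>i. \<alpha> ^ i)"
    using infinite_atoms_nat_poly_monoid assms(1,4) by blast
  \<comment> \<open>For \<open>\<alpha> = 1\<close> there would be only one power, hence one
    atom.\<close>
  have "\<alpha> \<noteq> 1" using assms(4) atoms by auto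
  then have inj: "inj (\<lambda>i. \<alpha> ^ i)"
    using assms(1) by (auto simp: inj_def power_inject_exp')
  obtain P Q where PQ: "P \<noteq> Q" "sum_mset P = sum_mset Q"
      "set_mset P \<subseteq> range (\<lambda>i. \<alpha> ^ i)" "set_mset Q \<subseteq> range (\<lambda>i. \<alpha> ^ i)"
    using algebraic_two_factorizations[OF assms(2) inj] by blast
  have ex: "\<exists>z. set_mset z \<subseteq> (\<lambda>i. \<alpha> ^ i) ` {N..} \<and> z \<noteq> {#} \<and> size z \<le> size P \<and> sum_mset z \<in> ?B" for N
  proof -
    \<comment> \<open>Scaling \<open>P\<close> and \<open>Q\<close> by \<open>\<alpha> ^ N\<close>
      pushes all exponents to at least \<open>N\<close>. It keeps them distinct with equal sums and
      does not change their sizes, so \<open>size P\<close> is a bound for every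
      \<open>N\<close>.\<close>
    let ?s = "image_mset ((*) (\<alpha> ^ N))"
    have shift: "set_mset (?s u) \<subseteq> (\<lambda>i. \<alpha> ^ i) ` {N..}" if u: "set_mset u \<subseteq> range (\<lambda>i. \<alpha> ^ i)" for u
    proof
      fix x assume "x \<in># ?s u"
      then obtain y where "y \<in># u" "x = \<alpha> ^ N * y" by auto
      moreover from this(1) obtain i where "y = \<alpha> ^ i" using u by blast
      ultimately have "x = \<alpha> ^ N * \<alpha> ^ i" by simp
      then show "x \<in> (\<lambda>i. \<alpha> ^ i) ` {N..}"
        by (intro image_eqI[of _ _ "N + i"]) (simp_all add: power_add)
    qed
    have "inj ((*) (\<alpha> ^ N))" using assms(1) by (simp add: inj_def)
    then have "inj ?s" by (rule multiset.inj_map)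
    then have "?s P \<noteq> ?s Q" using PQ(1) by (simp only: inj_eq not_False_eq_True)
    moreover have "sum_mset (?s P) = sum_mset (?s Q)"
      using sum_mset_distrib_left[of "\<alpha> ^ N" "\<lambda>x. x" P] sum_mset_distrib_left[of "\<alpha> ^ N" "\<lambda>x. x" Q] PQ(2)
      by simp
    moreover have "set_mset (?s Q) \<subseteq> range (\<lambda>i. \<alpha> ^ i)"
      using shift[OF PQ(4)] by blast
    ultimately obtain z where "set_mset z \<subseteq> (\<lambda>i. \<alpha> ^ i) ` {N..}" "z \<noteq> {#}" "size z \<le> size (?s P)"
        "betti_element (nat_poly_monoid \<alpha>) (sum_mset z)"
      using minimal_factorization_betti_element[OF assms(1,3) atoms shift[OF PQ(3)]] by blast
    then show ?thesis by auto
  qed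
  have lower: "\<exists>i\<ge>N. \<alpha> ^ i \<le> sum_mset z"
    if z: "set_mset z \<subseteq> (\<lambda>i. \<alpha> ^ i) ` {N..}" "z \<noteq> {#}" for z N
  proof -
    obtain a v where av: "z = add_mset a v" using z(2) multiset_cases by blast
    have "\<forall>x\<in>#v. x \<ge> 0" using z(1) av assms(1) by auto
    then have "sum_mset v \<ge> 0" by (induction v) auto
    then show ?thesis using z(1) av by auto
  qed
  have "\<alpha> > 1 \<or> \<alpha> < 1" using \<open>\<alpha> \<noteq> 1\<close> by auto
  then show False
  proof
    assume "\<alpha> > 1"
    \<comment> \<open>Any Betti element built from exponents at least \<open>N\<close> exceeds the
      supposed maximum.\<close>
    obtain N where N: "Max ?B < \<alpha> ^ N" using real_arch_pow[OF \<open>\<alpha> > 1\<close>] by blast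
    obtain z where z: "set_mset z \<subseteq> (\<lambda>i. \<alpha> ^ i) ` {N..}" "z \<noteq> {#}" "sum_mset z \<in> ?B"
      using ex by blast
    obtain i where "i \<ge> N" "\<alpha> ^ i \<le> sum_mset z" using lower[OF z(1,2)] by blast
    moreover have "\<alpha> ^ N \<le> \<alpha> ^ i" using \<open>\<alpha> > 1\<close> \<open>i \<ge> N\<close> by (simp add: power_increasing)
    moreover have "sum_mset z \<le> Max ?B" using fin z(3) by (rule Max_ge)
    ultimately show False using N by linarith
  next
    assume "\<alpha> < 1"
    \<comment> \<open>Inserting 1 makes the set visibly nonempty and the filter makes its minimum
      positive. The bound \<open>size P * \<alpha> ^ N\<close> tends to 0 and eventually drops below
      that minimum.\<close>
    let ?B' = "insert 1 {b \<in> ?B. b > 0}"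
    have fin': "finite ?B'" using fin by simp
    have "Min ?B' > 0" using fin' by (subst Min_gr_iff) auto
    moreover have "(\<lambda>N. real (size P) * \<alpha> ^ N) \<longlonglongrightarrow> real (size P) * 0"
      by (intro tendsto_intros LIMSEQ_power_zero) (use assms(1) \<open>\<alpha> < 1\<close> in simp)
    ultimately have "eventually (\<lambda>N. real (size P) * \<alpha> ^ N < Min ?B') sequentially"
      by (intro order_tendstoD) auto
    then obtain N where N: "real (size P) * \<alpha> ^ N < Min ?B'"
      by (auto simp: eventually_sequentially)
    obtain z where z: "set_mset z \<subseteq> (\<lambda>i. \<alpha> ^ i) ` {N..}" "z \<noteq> {#}" "size z \<le> size P"
        "sum_mset z \<in> ?B"
      using ex by blast
    have "sum_mset z > 0" using lower[OF z(1,2)] assms(1) by (auto intro: less_le_trans[rotated])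
    then have "Min ?B' \<le> sum_mset z" using fin' z(4) by (intro Min_le) auto
    moreover have "sum_mset z \<le> real (size z) * \<alpha> ^ N"
    proof (rule sum_mset_le_size_mult)
      fix x assume "x \<in># z"
      then obtain i where "i \<ge> N" "x = \<alpha> ^ i" using z(1) by auto
      then show "x \<le> \<alpha> ^ N" using assms(1) \<open>\<alpha> < 1\<close> by (simp add: power_decreasing)
    qed
    moreover have "real (size z) * \<alpha> ^ N \<le> real (size P) * \<alpha> ^ N"
      using z(3) assms(1) by (intro mult_right_mono) auto
    ultimately show False using N by linarith
  qed
qed

theorem proposition4p1:
  fixes \<alpha> :: real
  assumes "\<alpha> > 0"
    and "algebraic \<alpha>"
    and "atomic (nat_poly_monoid \<alpha>)"
  shows "finitely_generated (nat_poly_monoid \<alpha>) \<longleftrightarrow>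
         finite {b. betti_element (nat_poly_monoid \<alpha>) b}"
  \<comment> \<open>Both conditions are compared with finiteness of the set of atoms; (b) implies
    (a) by contraposition.\<close>
  using atomic_finitely_generated_iff[OF additive_submonoid_nat_poly_monoid assms(3)]
    finite_betti_elements[OF assms(3)] infinite_betti_elements[OF assms]
  by blast

end
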